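(* Let $\varepsilon>0$ be sufficiently small, let $k$ be an integer, and let $q\ge n$ with $q\gtrsim k/\varepsilon^2$ and $q>1/\varepsilon^2$. Put $N=q^k$ and $L=1/\varepsilon$, and let the block length $n$ satisfy $$n\ \ge\ \frac{2C_0\log(N)\log^5(L)}{\varepsilon},\qquad n\ \lesssim\ \frac{\log(N)\log^5(1/\varepsilon)}{\varepsilon},$$ where $C_0$ is an absolute constant. Choose evaluation points $\alpha_1,\dots,\alpha_n$ independently at random from $\mathbb{F}_q$, and let $\mathcal{C}\subset\mathbb{F}_q^n$ be the Reed-Solomon code that encodes a polynomial $f\in\mathbb{F}_q[x]$ of degree at most $k-1$ as $(f(\alpha_1),\dots,f(\alpha_n))$. Then $\mathcal{C}$ (whose generator matrix has full rank) has rate $$\Omega\left(\frac{\varepsilon}{\log(q)\log^5(1/\varepsilon)}\right),$$ has distance $1-\varepsilon$, and, with constant probability over the choice of the evaluation points, is list decodable up to radius $1-5\varepsilon$ with list sizes at most $1/\varepsilon$, i.e. is $(1-5\varepsilon,1/\varepsilon)$-list decodable.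
   Context: $\mathbb{F}_q$ is the field with $q$ elements. $d$ denotes relative Hamming distance on $\mathbb{F}_q^n$ (the fraction of coordinates in which two vectors differ), and the distance of a code is the minimum of $d$ over pairs of distinct codewords. A code $\mathcal{C}\subseteq\mathbb{F}_q^n$ is $(\rho,\ell)$-list decodable if for every $z\in\mathbb{F}_q^n$ the number of codewords $c\in\mathcal{C}$ with $d(z,c)\le\rho$ is at most $\ell$. The rate of a linear code is $\dim(\mathcal{C})/n$. $f\lesssim g$ (equivalently $g\gtrsim f$) means $f\le Cg$ for some absolute constant $C$; the constant in $\Omega$ is likewise absolute. $\log$ is the logarithm base $2$ and $\log^5(x)=(\log x)^5$.
   Formalization: Full rank, the rate and distance at least 1-ε are proved jointly with list decodability, with constant probability over the evaluation points; for unlucky points (e.g. only two distinct values occurring) the distance claim fails outright. *)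

theory Defs
  imports
    "HOL-Probability.Product_PMF"
    "HOL-Algebra.Polynomial_Divisibility"
    "Jordan_Normal_Form.Missing_VectorSpace"
begin

text \<open>
  A finite field is a HOL-Algebra structure \<open>F\<close> with finite carrier, so that theorems can quantify
  over all finite fields \<^emph>\<open>inside\<close> a formula, after absolute constants have been fixed. The carrier
  type \<open>'a\<close> stays arbitrary; its instance \<open>nat\<close> already covers all finite fields up to isomorphism
  with a single choice of constants.
  Vectors in \<open>F^n\<close> are the extensional functions \<open>{..<n} \<rightarrow>\<^sub>E carrier F\<close>, and \<open>ring.func_space F {..<n}\<close>
  is this set with its vector space structure.
\<close>

definition rel_hamming :: "nat \<Rightarrow> (nat \<Rightarrow> 'a) \<Rightarrow> (nat \<Rightarrow> 'a) \<Rightarrow> real" where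
  "rel_hamming n x y = real (card {i. i < n \<and> x i \<noteq> y i}) / real n"

text \<open>Only meaningful for codes with at least two codewords, as the minimum of the empty set is
  unspecified.\<close>

definition code_distance :: "nat \<Rightarrow> (nat \<Rightarrow> 'a) set \<Rightarrow> real" where
  "code_distance n C = Min {rel_hamming n c c' | c c'. c \<in> C \<and> c' \<in> C \<and> c \<noteq> c'}"

definition list_decodable ::
    "('a, 'b) ring_scheme \<Rightarrow> nat \<Rightarrow> real \<Rightarrow> real \<Rightarrow> (nat \<Rightarrow> 'a) set \<Rightarrow> bool" where
  "list_decodable F n \<rho> l C \<longleftrightarrow>
     (\<forall>z \<in> {..<n} \<rightarrow>\<^sub>E carrier F. real (card {c \<in> C. rel_hamming n z c \<le> \<rho>}) \<le> l)"

text \<open>Only meaningful for linear subspaces \<open>C\<close> of \<open>F^n\<close>.\<close>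

definition code_dim :: "('a, 'b) ring_scheme \<Rightarrow> nat \<Rightarrow> (nat \<Rightarrow> 'a) set \<Rightarrow> nat" where
  "code_dim F n C = vectorspace.dim F ((ring.func_space F {..<n})\<lparr>carrier := C\<rparr>)"

definition code_rate :: "('a, 'b) ring_scheme \<Rightarrow> nat \<Rightarrow> (nat \<Rightarrow> 'a) set \<Rightarrow> real" where
  "code_rate F n C = real (code_dim F n C) / real n"

text \<open>The evaluation points need not be distinct. In HOL-Algebra a polynomial is its list of
  coefficients, and \<open>degree p = length p - 1\<close>, so that the zero polynomial has degree \<open>0\<close>; for
  \<open>k \<ge> 1\<close> the set below is the space of polynomials of degree at most \<open>k - 1\<close>, zero included.\<close>

definition reed_solomon ::
    "('a, 'b) ring_scheme \<Rightarrow> nat \<Rightarrow> nat \<Rightarrow> (nat \<Rightarrow> 'a) \<Rightarrow> (nat \<Rightarrow> 'a) set" where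
  "reed_solomon F n k \<alpha> =
     (\<lambda>f. \<lambda>i\<in>{..<n}. ring.eval F f (\<alpha> i)) `
       {f \<in> carrier (univ_poly F (carrier F)). Polynomials.degree f \<le> k - 1}"

text \<open>The \<open>j\<close>-th column of the \<open>n \<times> k\<close> generator matrix \<open>(\<alpha>\<^sub>i ^ j)\<close> is the encoding of the
  monomial \<open>x ^ j\<close>.\<close>

definition rs_generator ::
    "('a, 'b) ring_scheme \<Rightarrow> nat \<Rightarrow> (nat \<Rightarrow> 'a) \<Rightarrow> nat \<Rightarrow> (nat \<Rightarrow> 'a)" where
  "rs_generator F n \<alpha> j = (\<lambda>i\<in>{..<n}. \<alpha> i [^]\<^bsub>F\<^esub> j)"

definition column_rank ::
    "('a, 'b) ring_scheme \<Rightarrow> nat \<Rightarrow> nat \<Rightarrow> (nat \<Rightarrow> nat \<Rightarrow> 'a) \<Rightarrow> nat" where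
  "column_rank F n k G =
     code_dim F n (LinearCombinations.module.span F (ring.func_space F {..<n}) (G ` {..<k}))"

text \<open>Independent uniform points of the field; outside \<open>{..<n}\<close> the sample is constantly
  \<open>undefined\<close>.\<close>

definition random_points :: "('a, 'b) ring_scheme \<Rightarrow> nat \<Rightarrow> (nat \<Rightarrow> 'a) pmf" where
  "random_points F n = Pi_pmf {..<n} undefined (\<lambda>_. pmf_of_set (carrier F))"

end

theory Submission
  imports Defs
begin

text \<open>
  If more than \<open>1 / \<epsilon>\<close> codewords agree with a centre on a \<open>5 \<epsilon>\<close> fraction of the coordinates, then on
  average at least five of them meet the centre in each coordinate, so for some dyadic level
  \<open>m = 2 ^ s\<close> at least \<open>4 n / (m s (s + 1))\<close> coordinates are met by \<open>m\<close> or more of them. A random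
  tuple of \<open>M \<approx> 4 / (\<epsilon> m)\<close> members of the list contains two distinct codewords meeting at such a
  coordinate with probability at least \<open>1 / 2\<close>. Hence some \<open>M\<close>-tuple of polynomials has
  \<open>2 n / (m s (s + 1))\<close> coordinates with a collision. For a fixed tuple a random evaluation point is a
  collision with probability at most \<open>M\<^sup>2 k / q\<close>, which is of order \<open>1 / m\<^sup>2\<close>, so a Chernoff bound beats
  the union bound over the \<open>N ^ M\<close> tuples. Shrinking the tuples as \<open>m\<close> grows is essential: the union
  bound over whole lists fails. Pairs of polynomials, \<open>M = 2\<close>, give the distance in the same way.
\<close>

section \<open>Collisions in random tuples\<close>

text \<open>If \<open>2 ^ t\<close> is the largest power of two below or equal to a positive
  \<open>a\<close>, the levels 1 to \<open>t\<close> contribute \<open>2 ^ (t + 1) - 2\<close>,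
  while \<open>a\<close> is at most \<open>2 ^ (t + 1) - 1\<close>. The summand 1 stands for level
  0.\<close>

lemma le_one_plus_sum_powers_of_two:
  fixes a :: nat
  assumes "a < 2 ^ Suc S"
  shows "a \<le> 1 + (\<Sum>s = 1..S. if 2 ^ s \<le> a then 2 ^ s else 0)"
  using assms
proof (induction S)
  case (Suc S)
  show ?case
  proof (cases "a < 2 ^ Suc S")
    case True
    then show ?thesis using Suc.IH by simp
  next
    case False
    have "(2::nat) ^ s \<le> a" if "s \<le> Suc S" for s
      using False power_increasing[OF that, of "2::nat"] by simp
    then have "(\<Sum>s = 1..Suc S. if 2 ^ s \<le> a then 2 ^ s else 0) = (\<Sum>s = 1..Suc S. (2::nat) ^ s)"
      by (intro sum.cong) auto
    moreover have "(\<Sum>s = 1..m. (2::nat) ^ s) + 2 = 2 ^ Suc m" for m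
      by (induction m) (simp_all only: sum.cl_ivl_Suc, simp_all)
    from this[of "Suc S"] have "a + 1 \<le> (\<Sum>s = 1..Suc S. (2::nat) ^ s) + 2"
      using Suc.prems by linarith
    ultimately show ?thesis by linarith
  qed
qed simp

lemma sum_inverse_consecutive_products:
  "(\<Sum>s = 1..S. 1 / (real s * (real s + 1))) = 1 - 1 / (real S + 1)"
proof (induction S)
  case (Suc S)
  have "1 - 1 / (x + 1) + 1 / ((x + 1) * (x + 1 + 1)) = 1 - 1 / (x + 1 + 1)" if "x \<ge> 0" for x :: real
    using that by (simp add: divide_simps) (simp add: algebra_simps)
  from this[of "real S"] Suc show ?case by (simp add: add.commute)
qed simp

text \<open>
  The weights \<open>4 / (s (s + 1))\<close> sum to \<open>4\<close> and decay slowly enough that level \<open>s\<close> only loses a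
  factor of order \<open>log\<^sup>2 (1 / \<epsilon>)\<close>.
\<close>
lemma heavy_dyadic_level:
  fixes a :: "nat \<Rightarrow> nat"
  assumes "n > 0" and total: "5 * real n \<le> (\<Sum>j<n. real (a j))"
  shows "\<exists>s\<ge>1. 4 * real n / (2 ^ s * (real s * (real s + 1))) \<le> real (card {j. j < n \<and> 2 ^ s \<le> a j})"
proof (rule ccontr)
  assume none: "\<not> ?thesis"
  have light: "2 ^ s * real (card {j. j < n \<and> 2 ^ s \<le> a j})
      \<le> 4 * real n * (1 / (real s * (real s + 1)))" if "s \<ge> 1" for s
  proof -
    have "real (card {j. j < n \<and> 2 ^ s \<le> a j}) \<le> 4 * real n / (2 ^ s * (real s * (real s + 1)))"
      using none that by (meson linear)
    from mult_left_mono[OF this, of "2 ^ s"] show ?thesis by simp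
  qed
  \<comment> \<open>Any bound beyond which all levels are empty will do; the sum of all
    multiplicities is a crude one.\<close>
  define S where "S = (\<Sum>j<n. a j)"
  have "a j < 2 ^ Suc S" if "j < n" for j
  proof -
    have "a j \<le> S" unfolding S_def using that by (intro member_le_sum) auto
    also have "S < 2 ^ S" by (rule less_exp)
    finally show ?thesis by simp
  qed
  then have "(\<Sum>j<n. a j) \<le> (\<Sum>j<n. 1 + (\<Sum>s = 1..S. if 2 ^ s \<le> a j then 2 ^ s else 0))"
    by (intro sum_mono le_one_plus_sum_powers_of_two) auto
  also have "\<dots> = n + (\<Sum>s = 1..S. \<Sum>j<n. if 2 ^ s \<le> a j then 2 ^ s else 0)"
    by (subst sum.distrib, subst sum.swap) simp
  also have "(\<Sum>s = 1..S. \<Sum>j<n. if 2 ^ s \<le> a j then 2 ^ s else 0) =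
      (\<Sum>s = 1..S. 2 ^ s * card {j. j < n \<and> 2 ^ s \<le> a j})"
    by (intro sum.cong) (auto simp: sum.If_cases Int_def)
  finally have "real (\<Sum>j<n. a j) \<le> real (n + (\<Sum>s = 1..S. 2 ^ s * card {j. j < n \<and> 2 ^ s \<le> a j}))"
    by (simp only: of_nat_le_iff)
  then have "(\<Sum>j<n. real (a j)) \<le> n + (\<Sum>s = 1..S. 2 ^ s * real (card {j. j < n \<and> 2 ^ s \<le> a j}))"
    by simp
  also have "\<dots> \<le> n + (\<Sum>s = 1..S. 4 * real n * (1 / (real s * (real s + 1))))"
    by (intro add_left_mono sum_mono light) auto
  also have "\<dots> = n + 4 * real n * (1 - 1 / (real S + 1))"
    by (simp only: sum_distrib_left[symmetric] sum_inverse_consecutive_products)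
  \<comment> \<open>The weights of finitely many levels sum to strictly less than 4, and level 0
    adds at most 1 per coordinate. This is why an average of 5 is asked for.\<close>
  also have "\<dots> < 5 * real n"
    using \<open>n > 0\<close> by (simp add: field_simps)
  finally show False using total by simp
qed

section \<open>Uniform tuples and the sets they hit\<close>

text \<open>A uniform tuple avoids \<open>U\<close> with probability \<open>(1 - m / l) ^ M\<close>,
  which is at most \<open>exp (- 2)\<close> because \<open>M * m\<close> is at least
  \<open>2 * l\<close>. With the bound 1/4, two such events can be excluded at a total cost of
  1/2.\<close>

lemma card_tuples_avoiding_le:
  assumes "finite \<Lambda>" "U \<subseteq> \<Lambda>" "\<Lambda> \<noteq> {}" "2 * card \<Lambda> \<le> M * card U"
  shows "4 * card ({..<M} \<rightarrow>\<^sub>E (\<Lambda> - U)) \<le> card ({..<M} \<rightarrow>\<^sub>E \<Lambda>)"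
proof -
  define l m where "l = real (card \<Lambda>)" and "m = real (card U)"
  have l: "l > 0" unfolding l_def using assms by (simp add: card_gt_0_iff)
  have "card U \<le> card \<Lambda>" using assms by (intro card_mono) auto
  then have ml: "m \<le> l" by (simp add: l_def m_def)
  have "real (2 * card \<Lambda>) \<le> real (M * card U)" using assms(4) by (simp only: of_nat_le_iff)
  then have lM: "2 * l \<le> M * m" by (simp add: l_def m_def)
  have "(l - m) ^ M = l ^ M * (1 - m / l) ^ M"
    using l by (simp add: power_mult_distrib[symmetric] field_simps)
  also have "(1 - m / l) ^ M \<le> exp (- (m / l)) ^ M"
    using ml l exp_ge_add_one_self[of "- (m / l)"] by (intro power_mono) auto
  also have "\<dots> = exp (- (M * (m / l)))" by (simp add: exp_of_nat_mult[symmetric])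
  also have "\<dots> \<le> exp (- 2)" using lM l by (simp add: field_simps)
  also have "exp (- 2 :: real) \<le> 1 / 4"
  proof -
    have "(2::real) ^ 2 \<le> exp 1 ^ 2" using exp_ge_add_one_self[of 1] by (intro power_mono) auto
    then show ?thesis by (simp add: exp_minus field_simps exp_of_nat_mult[symmetric])
  qed
  finally have "(l - m) ^ M \<le> l ^ M / 4" using l by simp
  moreover have "real (card (\<Lambda> - U)) = l - m"
    using assms \<open>card U \<le> card \<Lambda>\<close> by (simp add: card_Diff_subset finite_subset l_def m_def of_nat_diff)
  ultimately have "real (4 * card ({..<M} \<rightarrow>\<^sub>E (\<Lambda> - U))) \<le> real (card ({..<M} \<rightarrow>\<^sub>E \<Lambda>))"
    by (simp add: card_PiE l_def)
  then show ?thesis by (simp only: of_nat_le_iff)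
qed

text \<open>First moment method: over a uniform tuple, each coordinate of \<open>J\<close> sees a
  collision with probability at least 1/2, so some tuple collides on at least half of
  \<open>J\<close>.\<close>

lemma exists_colliding_tuple:
  assumes "finite \<Lambda>" "\<Lambda> \<noteq> {}" "finite J"
    and A: "\<And>j. j \<in> J \<Longrightarrow> A j \<subseteq> \<Lambda>" "\<And>j. j \<in> J \<Longrightarrow> 2 * m \<le> card (A j)"
    and M: "2 * card \<Lambda> \<le> M * m"
  shows "\<exists>g \<in> {..<M} \<rightarrow>\<^sub>E \<Lambda>.
    card J \<le> 2 * card {j \<in> J. \<exists>a<M. \<exists>b<M. g a \<noteq> g b \<and> g a \<in> A j \<and> g b \<in> A j}"
proof -
  define G where "G = {..<M} \<rightarrow>\<^sub>E \<Lambda>"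
  define H where "H g j \<longleftrightarrow> (\<exists>a<M. \<exists>b<M. g a \<noteq> g b \<and> g a \<in> A j \<and> g b \<in> A j)" for g j
  have fG: "finite G" unfolding G_def using assms by (intro finite_PiE) auto
  have G0: "card G > 0" unfolding G_def using assms by (auto simp: card_gt_0_iff PiE_eq_empty_iff finite_PiE)
  have half: "card G \<le> 2 * card {g \<in> G. H g j}" if j: "j \<in> J" for j
  proof -
    \<comment> \<open>Only hitting both of two disjoint halves of \<open>A j\<close> guarantees two distinct entries in \<open>A j\<close>.\<close>
    obtain U where U: "U \<subseteq> A j" "card U = m"
      using A(2)[OF j] obtain_subset_with_card_n[of m "A j"] by auto
    have fA: "finite (A j)" using A(1)[OF j] assms(1) finite_subset by blast
    have "m \<le> card (A j - U)" using A(2)[OF j] U fA by (simp add: card_Diff_subset finite_subset)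
    then obtain V where V: "V \<subseteq> A j - U" "card V = m"
      using obtain_subset_with_card_n by metis
    have "G \<subseteq> {g \<in> G. H g j} \<union> (({..<M} \<rightarrow>\<^sub>E (\<Lambda> - U)) \<union> ({..<M} \<rightarrow>\<^sub>E (\<Lambda> - V)))"
    proof
      fix g assume g: "g \<in> G"
      show "g \<in> {g \<in> G. H g j} \<union> (({..<M} \<rightarrow>\<^sub>E (\<Lambda> - U)) \<union> ({..<M} \<rightarrow>\<^sub>E (\<Lambda> - V)))"
      proof (cases "(\<exists>a<M. g a \<in> U) \<and> (\<exists>b<M. g b \<in> V)")
        case True
        then obtain a b where "a < M" "b < M" "g a \<in> U" "g b \<in> V" by blast
        moreover from this have "g a \<noteq> g b" "g a \<in> A j" "g b \<in> A j" using U(1) V(1) by auto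
        ultimately have "H g j" unfolding H_def by blast
        then show ?thesis using g by simp
      next
        case False
        then show ?thesis using g unfolding G_def by (auto simp: PiE_iff)
      qed
    qed
    then have "card G \<le> card ({g \<in> G. H g j} \<union> (({..<M} \<rightarrow>\<^sub>E (\<Lambda> - U)) \<union> ({..<M} \<rightarrow>\<^sub>E (\<Lambda> - V))))"
      using fG assms(1) by (intro card_mono) (auto intro: finite_PiE)
    also have "\<dots> \<le> card {g \<in> G. H g j} + (card ({..<M} \<rightarrow>\<^sub>E (\<Lambda> - U)) + card ({..<M} \<rightarrow>\<^sub>E (\<Lambda> - V)))"
      by (meson add_left_mono card_Un_le order_trans)
    finally have "card G \<le> \<dots>" .
    moreover have "4 * card ({..<M} \<rightarrow>\<^sub>E (\<Lambda> - U)) \<le> card G" "4 * card ({..<M} \<rightarrow>\<^sub>E (\<Lambda> - V)) \<le> card G"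
      unfolding G_def using U V A(1)[OF j] assms by (intro card_tuples_avoiding_le; auto)+
    ultimately show ?thesis by linarith
  qed
  \<comment> \<open>Double counting of the pairs of a tuple and a coordinate at which it
    collides.\<close>
  have "\<exists>g\<in>G. card J \<le> 2 * card {j \<in> J. H g j}"
  proof (rule ccontr)
    assume "\<not> ?thesis"
    then have less: "2 * card {j \<in> J. H g j} < card J" if "g \<in> G" for g using that by (auto simp: not_le)
    have "card J * card G = (\<Sum>j\<in>J. card G)" by simp
    also have "\<dots> \<le> (\<Sum>j\<in>J. 2 * card {g \<in> G. H g j})" by (intro sum_mono half)
    also have "\<dots> = (\<Sum>g\<in>G. 2 * card {j \<in> J. H g j})"
      unfolding sum_distrib_left[symmetric]
      using sum_multicount_gen[of J G "\<lambda>j g. H g j" "\<lambda>g. card {j \<in> J. H g j}"] fG assms(3) by simp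
    also have "\<dots> < (\<Sum>g\<in>G. card J)" using fG G0 less by (intro sum_strict_mono) auto
    also have "\<dots> = card J * card G" by simp
    finally show False by simp
  qed
  then show ?thesis by (simp add: G_def H_def)
qed

section \<open>Random puncturing\<close>

text \<open>Chernoff bound: apply Markov to the exponential of the count. One point contributes the
  factor \<open>1 + (exp 1 - 1) * p\<close> at most, and \<open>exp 1 - 1\<close> is at most 2, so
  the factor is bounded by \<open>exp (2 * p)\<close>.\<close>

lemma prob_many_points_in_set_le:
  fixes p T :: real
  assumes \<Omega>: "finite \<Omega>" "\<Omega> \<noteq> {}" and B: "B \<subseteq> \<Omega>" "real (card B) \<le> p * real (card \<Omega>)"
  shows "measure_pmf.prob (Pi_pmf {..<n} d (\<lambda>_. pmf_of_set \<Omega>))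
      {\<alpha>. T \<le> real (card {i. i < n \<and> \<alpha> i \<in> B})} \<le> exp (2 * real n * p - T)"
proof -
  define \<xi> where "\<xi> = Pi_pmf {..<n} d (\<lambda>_. pmf_of_set \<Omega>)"
  \<comment> \<open>\<open>Z\<close> is the exponential of the count, written as a product of
    functions of single coordinates so that independence turns its expectation into a
    product.\<close>
  define w where "w x = (if x \<in> B then exp 1 else 1 :: real)" for x
  define Z where "Z \<alpha> = (\<Prod>i<n. w (\<alpha> i))" for \<alpha>
  have cX: "card \<Omega> > 0" using \<Omega> by (simp add: card_gt_0_iff)
  have fin: "finite (set_pmf \<xi>)"
    unfolding \<xi>_def using \<Omega> by (simp add: set_Pi_pmf finite_PiE_dflt)
  have Z: "Z \<alpha> = exp (real (card {i. i < n \<and> \<alpha> i \<in> B}))" for \<alpha>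
  proof -
    have "Z \<alpha> = (\<Prod>i\<in>{i. i < n \<and> \<alpha> i \<in> B}. exp 1)"
      unfolding Z_def w_def by (subst prod.If_cases) (auto simp: Int_def)
    also have "\<dots> = exp 1 ^ card {i. i < n \<and> \<alpha> i \<in> B}" by (rule prod_constant)
    finally show ?thesis by (simp add: exp_of_nat_mult[symmetric])
  qed
  have e: "exp 1 \<le> (3::real)" by (rule exp_le)
  have one: "measure_pmf.expectation (pmf_of_set \<Omega>) w \<le> exp (2 * p)"
  proof -
    have "measure_pmf.expectation (pmf_of_set \<Omega>) w = (\<Sum>x\<in>\<Omega>. w x) / card \<Omega>"
      using \<Omega> by (simp add: integral_pmf_of_set)
    also have "(\<Sum>x\<in>\<Omega>. w x) = (\<Sum>x\<in>\<Omega>. 1 + (if x \<in> B then exp 1 - 1 else 0))"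
      unfolding w_def by (intro sum.cong) auto
    also have "\<dots> = real (card \<Omega>) + (exp 1 - 1) * real (card B)"
      using \<Omega> B(1) by (subst sum.distrib) (simp add: sum.If_cases Int_absorb1)
    also have "\<dots> \<le> real (card \<Omega>) + 2 * (p * real (card \<Omega>))"
      using B(2) e by (intro add_left_mono mult_mono) auto
    finally have "measure_pmf.expectation (pmf_of_set \<Omega>) w
        \<le> (real (card \<Omega>) + 2 * (p * real (card \<Omega>))) / card \<Omega>"
      by (simp add: divide_right_mono)
    also have "\<dots> = 1 + 2 * p" using cX by (simp add: add_divide_distrib)
    also have "\<dots> \<le> exp (2 * p)" by (rule exp_ge_add_one_self)
    finally show ?thesis .
  qed
  have "measure_pmf.expectation \<xi> Z = (\<Prod>i<n. measure_pmf.expectation (pmf_of_set \<Omega>) w)"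
    unfolding \<xi>_def Z_def
    by (subst expectation_prod_Pi_pmf)
       (auto simp: w_def intro: integrable_measure_pmf_finite
        simp: set_pmf_of_set[OF \<Omega>(2,1)] \<Omega>)
  also have "\<dots> \<le> (\<Prod>i<n. exp (2 * p))"
    by (intro prod_mono) (auto intro!: one Bochner_Integration.integral_nonneg simp: w_def)
  also have "\<dots> = exp (2 * real n * p)" by (simp add: exp_of_nat_mult[symmetric] mult_ac)
  finally have E: "measure_pmf.expectation \<xi> Z \<le> exp (2 * real n * p)" .
  have "measure_pmf.prob \<xi> {\<alpha> \<in> space \<xi>. exp T \<le> Z \<alpha>} \<le> measure_pmf.expectation \<xi> Z / exp T"
    by (intro integral_Markov_inequality_measure[where A = "{}"])
       (auto simp: Z intro: integrable_measure_pmf_finite[OF fin])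
  also have "\<dots> \<le> exp (2 * real n * p) / exp T" using E by (intro divide_right_mono) auto
  also have "{\<alpha> \<in> space \<xi>. exp T \<le> Z \<alpha>} = {\<alpha>. T \<le> real (card {i. i < n \<and> \<alpha> i \<in> B})}"
    by (simp add: Z)
  finally show ?thesis by (simp add: \<xi>_def exp_diff)
qed

text \<open>The entries are compared, not the indices: tuples may repeat an entry, and an entry
  trivially agrees with itself. \<open>ev\<close> is left abstract, so that puncturing applies to
  any mother code.\<close>

definition collision_points :: "'x set \<Rightarrow> ('f \<Rightarrow> 'x \<Rightarrow> 'y) \<Rightarrow> nat \<Rightarrow> (nat \<Rightarrow> 'f) \<Rightarrow> 'x set" where
  "collision_points \<Omega> ev M g = {x \<in> \<Omega>. \<exists>a<M. \<exists>b<M. g a \<noteq> g b \<and> ev (g a) x = ev (g b) x}"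

text \<open>Union bound over the \<open>M ^ 2\<close> ordered pairs of indices; a pair with equal
  entries contributes the empty set.\<close>

lemma card_collision_points_le:
  fixes \<kappa> :: real
  assumes "finite \<Omega>" "\<kappa> \<ge> 0" and g: "g \<in> {..<M} \<rightarrow>\<^sub>E P"
    and dist: "\<And>f h. f \<in> P \<Longrightarrow> h \<in> P \<Longrightarrow> f \<noteq> h \<Longrightarrow>
      real (card {x \<in> \<Omega>. ev f x = ev h x}) \<le> \<kappa> * real (card \<Omega>)"
  shows "real (card (collision_points \<Omega> ev M g)) \<le> real M ^ 2 * \<kappa> * real (card \<Omega>)"
proof -
  define S where "S = (\<lambda>(a, b). {x \<in> \<Omega>. g a \<noteq> g b \<and> ev (g a) x = ev (g b) x})"
  have "collision_points \<Omega> ev M g = (\<Union>ab \<in> {..<M} \<times> {..<M}. S ab)"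
    by (auto simp: collision_points_def S_def)
  then have "card (collision_points \<Omega> ev M g) \<le> (\<Sum>ab \<in> {..<M} \<times> {..<M}. card (S ab))"
    using card_UN_le[of "{..<M} \<times> {..<M}" S] by simp
  then have "real (card (collision_points \<Omega> ev M g)) \<le> (\<Sum>ab \<in> {..<M} \<times> {..<M}. real (card (S ab)))"
    by (metis of_nat_mono of_nat_sum)
  also have "\<dots> \<le> (\<Sum>ab \<in> {..<M} \<times> {..<M}. \<kappa> * real (card \<Omega>))"
  proof (intro sum_mono)
    fix ab assume "ab \<in> {..<M} \<times> {..<M}"
    then obtain a b where ab: "ab = (a, b)" "a < M" "b < M" by auto
    show "real (card (S ab)) \<le> \<kappa> * real (card \<Omega>)"
    proof (cases "g a = g b")
      case True
      then show ?thesis using ab assms(2) by (simp add: S_def)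
    next
      case False
      then show ?thesis using ab g dist[of "g a" "g b"] by (auto simp: S_def)
    qed
  qed
  also have "\<dots> = real M ^ 2 * \<kappa> * real (card \<Omega>)"
    by (simp add: power2_eq_square)
  finally show ?thesis .
qed

text \<open>There are at most \<open>exp (M * D)\<close> tuples, and for each of them a random point
  is a collision with probability at most \<open>M ^ 2 * \<kappa>\<close>, which is the
  \<open>p\<close> of the Chernoff bound.\<close>

lemma prob_some_tuple_collides_often_le:
  fixes \<kappa> T D :: real
  assumes "finite \<Omega>" "\<Omega> \<noteq> {}" "finite P" "\<kappa> \<ge> 0" "real (card P) \<le> exp D"
    and dist: "\<And>f h. f \<in> P \<Longrightarrow> h \<in> P \<Longrightarrow> f \<noteq> h \<Longrightarrow>
      real (card {x \<in> \<Omega>. ev f x = ev h x}) \<le> \<kappa> * real (card \<Omega>)"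
  shows "measure_pmf.prob (Pi_pmf {..<n} d (\<lambda>_. pmf_of_set \<Omega>))
      {\<alpha>. \<exists>g \<in> {..<M} \<rightarrow>\<^sub>E P. T \<le> real (card {i. i < n \<and> \<alpha> i \<in> collision_points \<Omega> ev M g})}
    \<le> exp (real M * D + 2 * real n * (real M ^ 2 * \<kappa>) - T)"
proof -
  define \<xi> where "\<xi> = Pi_pmf {..<n} d (\<lambda>_. pmf_of_set \<Omega>)"
  define Ev where "Ev g = {\<alpha>. T \<le> real (card {i. i < n \<and> \<alpha> i \<in> collision_points \<Omega> ev M g})}" for g
  define G where "G = {..<M} \<rightarrow>\<^sub>E P"
  define c where "c = exp (2 * real n * (real M ^ 2 * \<kappa>) - T)"
  have fG: "finite G" unfolding G_def using assms by (intro finite_PiE) auto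
  have "measure_pmf.prob \<xi> (\<Union>g\<in>G. Ev g) \<le> (\<Sum>g\<in>G. measure_pmf.prob \<xi> (Ev g))"
    by (intro measure_pmf.finite_measure_subadditive_finite fG) auto
  also have "\<dots> \<le> (\<Sum>g\<in>G. c)"
    unfolding \<xi>_def Ev_def c_def
  proof (intro sum_mono prob_many_points_in_set_le assms(1,2))
    fix g assume "g \<in> G"
    then show "real (card (collision_points \<Omega> ev M g)) \<le> real M ^ 2 * \<kappa> * real (card \<Omega>)"
      using card_collision_points_le[of \<Omega> \<kappa> g M P ev] dist assms by (auto simp: G_def)
  qed (auto simp: collision_points_def)
  also have "\<dots> = real (card P) ^ M * c" by (simp add: G_def card_PiE)
  also have "\<dots> \<le> exp D ^ M * c"
    using assms(5) by (intro mult_right_mono power_mono) (auto simp: c_def)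
  also have "\<dots> = exp (real M * D + 2 * real n * (real M ^ 2 * \<kappa>) - T)"
    by (simp add: c_def exp_of_nat_mult[symmetric] exp_add[symmetric] algebra_simps)
  also have "(\<Union>g\<in>G. Ev g) = {\<alpha>. \<exists>g \<in> {..<M} \<rightarrow>\<^sub>E P. T \<le> real (card {i. i < n \<and> \<alpha> i \<in> collision_points \<Omega> ev M g})}"
    by (auto simp: G_def Ev_def)
  finally show ?thesis by (simp add: \<xi>_def)
qed

section \<open>From a large list to a colliding tuple\<close>

text \<open>The level \<open>s\<close> depends only on the list and the centre, and any tuple length
  \<open>M\<close> that is large enough for this level works. The threshold is half the number of
  heavy coordinates, the other half being lost to averaging over tuples.\<close>

lemma large_list_yields_colliding_tuple:
  fixes \<epsilon> :: real
  assumes "n > 0" "finite \<Lambda>" "1 \<le> \<epsilon> * real (card \<Lambda>)"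
    and \<alpha>: "\<And>i. i < n \<Longrightarrow> \<alpha> i \<in> \<Omega>"
    and agree: "\<And>f. f \<in> \<Lambda> \<Longrightarrow> 5 * \<epsilon> * real n \<le> real (card {i. i < n \<and> ev f (\<alpha> i) = z i})"
  shows "\<exists>s\<ge>1. 2 ^ s \<le> card \<Lambda> \<and> (\<forall>M. 4 * card \<Lambda> \<le> M * 2 ^ s \<longrightarrow>
    (\<exists>g \<in> {..<M} \<rightarrow>\<^sub>E \<Lambda>. 2 * real n / (2 ^ s * (real s * (real s + 1)))
       \<le> real (card {i. i < n \<and> \<alpha> i \<in> collision_points \<Omega> ev M g})))"
proof -
  define A where "A j = {f \<in> \<Lambda>. ev f (\<alpha> j) = z j}" for j
  \<comment> \<open>Counting agreements by codeword and by coordinate: at least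
    \<open>1 / \<epsilon>\<close> codewords with \<open>5 * \<epsilon> * n\<close> agreements
    each.\<close>
  have "5 * real n \<le> real n * 5 * (\<epsilon> * real (card \<Lambda>))"
    using assms(3) \<open>n > 0\<close> by (simp add: mult_left_mono)
  also have "\<dots> = (\<Sum>f\<in>\<Lambda>. 5 * \<epsilon> * real n)" by simp
  also have "\<dots> \<le> (\<Sum>f\<in>\<Lambda>. real (card {i. i < n \<and> ev f (\<alpha> i) = z i}))"
    by (intro sum_mono agree)
  also have "\<dots> = real (\<Sum>f\<in>\<Lambda>. card {i \<in> {..<n}. ev f (\<alpha> i) = z i})" by simp
  also have "(\<Sum>f\<in>\<Lambda>. card {i \<in> {..<n}. ev f (\<alpha> i) = z i}) = (\<Sum>i<n. card (A i))"
    unfolding A_def using sum_multicount_gen[of \<Lambda> "{..<n}" "\<lambda>f i. ev f (\<alpha> i) = z i"] assms(2) by simp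
  finally have "5 * real n \<le> (\<Sum>i<n. real (card (A i)))" by simp
  from heavy_dyadic_level[OF \<open>n > 0\<close> this] obtain s where s: "s \<ge> 1"
    and heavy: "4 * real n / (2 ^ s * (real s * (real s + 1))) \<le> real (card {j. j < n \<and> 2 ^ s \<le> card (A j)})"
    by blast
  define J where "J = {j. j < n \<and> 2 ^ s \<le> card (A j)}"
  \<comment> \<open>Some coordinate is heavy, so \<open>2 ^ s\<close> cannot exceed the length of
    the list. This bounds the number of levels for the later union bound.\<close>
  have "4 * real n / (2 ^ s * (real s * (real s + 1))) > 0" using s \<open>n > 0\<close> by simp
  then have "card J > 0" using heavy by (simp add: J_def)
  then obtain j where "j \<in> J" by (metis card.empty equals0I less_irrefl)
  moreover have "card (A j) \<le> card \<Lambda>" using assms(2) by (intro card_mono) (auto simp: A_def)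
  ultimately have le: "2 ^ s \<le> card \<Lambda>" by (simp add: J_def)
  have "\<exists>g \<in> {..<M} \<rightarrow>\<^sub>E \<Lambda>. 2 * real n / (2 ^ s * (real s * (real s + 1)))
       \<le> real (card {i. i < n \<and> \<alpha> i \<in> collision_points \<Omega> ev M g})" if M: "4 * card \<Lambda> \<le> M * 2 ^ s" for M
  proof -
    \<comment> \<open>A positive level has an even size \<open>2 ^ s\<close>, which splits into two
      disjoint halves of size \<open>2 ^ r\<close>.\<close>
    obtain r where r: "s = Suc r" using s by (cases s) auto
    have "\<exists>g \<in> {..<M} \<rightarrow>\<^sub>E \<Lambda>.
        card J \<le> 2 * card {j \<in> J. \<exists>a<M. \<exists>b<M. g a \<noteq> g b \<and> g a \<in> A j \<and> g b \<in> A j}"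
      using M le assms(2) by (intro exists_colliding_tuple[where m = "2 ^ r"]) (auto simp: J_def A_def r)
    then obtain g where g: "g \<in> {..<M} \<rightarrow>\<^sub>E \<Lambda>"
      "card J \<le> 2 * card {j \<in> J. \<exists>a<M. \<exists>b<M. g a \<noteq> g b \<and> g a \<in> A j \<and> g b \<in> A j}" by blast
    have "{j \<in> J. \<exists>a<M. \<exists>b<M. g a \<noteq> g b \<and> g a \<in> A j \<and> g b \<in> A j}
        \<subseteq> {i. i < n \<and> \<alpha> i \<in> collision_points \<Omega> ev M g}"
    proof
      fix j assume "j \<in> {j \<in> J. \<exists>a<M. \<exists>b<M. g a \<noteq> g b \<and> g a \<in> A j \<and> g b \<in> A j}"
      then obtain a b where "j < n" "a < M" "b < M" "g a \<noteq> g b" "ev (g a) (\<alpha> j) = ev (g b) (\<alpha> j)"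
        by (auto simp: J_def A_def)
      then show "j \<in> {i. i < n \<and> \<alpha> i \<in> collision_points \<Omega> ev M g}"
        using \<alpha> unfolding collision_points_def by blast
    qed
    then have "card {j \<in> J. \<exists>a<M. \<exists>b<M. g a \<noteq> g b \<and> g a \<in> A j \<and> g b \<in> A j}
        \<le> card {i. i < n \<and> \<alpha> i \<in> collision_points \<Omega> ev M g}"
      by (intro card_mono) auto
    with g(2) have "card J \<le> 2 * card {i. i < n \<and> \<alpha> i \<in> collision_points \<Omega> ev M g}" by linarith
    then have "real (card J) \<le> 2 * real (card {i. i < n \<and> \<alpha> i \<in> collision_points \<Omega> ev M g})" by linarith
    moreover have "2 * (2 * real n / (2 ^ s * (real s * (real s + 1)))) \<le> real (card J)"
      using heavy by (simp add: J_def)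
    ultimately show ?thesis using g(1) by (intro bexI[of _ g]) linarith
  qed
  with s le show ?thesis by blast
qed

section \<open>Numerical estimates for the union bound\<close>

lemma two_le_log_inverse:
  fixes \<epsilon> :: real
  assumes "0 < \<epsilon>" "\<epsilon> < 1 / 4"
  shows "2 \<le> log 2 (1 / \<epsilon>)"
proof -
  have "log 2 (2 powr 2) \<le> log 2 (1 / \<epsilon>)"
    using assms by (subst log_le_cancel_iff) (auto simp: field_simps)
  then show ?thesis by (simp only: log_powr_cancel)
qed

text \<open>With \<open>m = 2 ^ s\<close> and \<open>t = s * (s + 1)\<close>, the expectation term
  takes at most half of the threshold \<open>2 * n / (m * t)\<close>. The other half is at least
  \<open>20 * \<gamma> ^ 3 * D / (\<epsilon> * m)\<close> and beats the entropy term
  \<open>10 * D / (\<epsilon> * m)\<close>. The margin \<open>8 * \<gamma>\<close> pays for summing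
  over all levels.\<close>

lemma level_exponent_le:
  fixes \<epsilon> \<kappa> D \<gamma> :: real
  defines "\<gamma> \<equiv> log 2 (1 / \<epsilon>)"
  assumes \<epsilon>: "0 < \<epsilon>" "\<epsilon> < 1 / 4" and \<kappa>: "0 \<le> \<kappa>" "\<kappa> \<le> \<epsilon>\<^sup>2 / 400" and D: "1 \<le> D"
    and n: "real n \<ge> 80 * D * \<gamma> ^ 5 / \<epsilon>"
    and s: "1 \<le> s" "2 ^ s \<le> 2 / \<epsilon>" and M: "real M \<le> 10 / (\<epsilon> * 2 ^ s)"
  shows "real M * D + 2 * real n * (real M ^ 2 * \<kappa>) - 2 * real n / (2 ^ s * (real s * (real s + 1)))
    \<le> - (8 * \<gamma>)"
proof -
  define m where "m = (2::real) ^ s"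
  define t where "t = real s * (real s + 1)"
  have m: "m > 0" by (simp add: m_def)
  have t: "t > 0" using s by (simp add: t_def)
  have \<gamma>: "\<gamma> \<ge> 2" unfolding \<gamma>_def using \<epsilon> by (intro two_le_log_inverse)
  \<comment> \<open>The second conjunct strengthens the induction hypothesis: the step adds
    \<open>2 * (s + 1)\<close> to the left side.\<close>
  have tm: "t \<le> 2 * m"
    unfolding t_def m_def
  proof -
    have "real s * (real s + 1) \<le> 2 * 2 ^ s \<and> real s + 1 \<le> 2 ^ s" using s(1)
    proof (induction s rule: dec_induct)
      case (step s)
      then show ?case by (simp add: algebra_simps)
    qed simp
    then show "real s * (real s + 1) \<le> 2 * 2 ^ s" by simp
  qed
  have "real s = log 2 (2 ^ s)" by simp
  also have "\<dots> \<le> log 2 (2 / \<epsilon>)" using s \<epsilon> by (subst log_le_cancel_iff) auto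
  also have "\<dots> = \<gamma> + 1" unfolding \<gamma>_def using \<epsilon> by (simp add: log_divide)
  finally have s\<gamma>: "real s \<le> \<gamma> + 1" .
  \<comment> \<open>Since \<gamma> is at least 2, both \<open>s\<close> and \<open>s + 1\<close> are
    at most \<open>\<gamma> + 2\<close>, hence at most \<open>2 * \<gamma>\<close>. The level weight
    thus costs two of the five logarithmic factors in \<open>n\<close>.\<close>
  have "t \<le> (2 * \<gamma>) * (2 * \<gamma>)"
    unfolding t_def using s\<gamma> \<gamma> by (intro mult_mono) auto
  then have t\<gamma>: "t \<le> 4 * \<gamma>\<^sup>2" by (simp add: power2_eq_square)
  \<comment> \<open>The constant 400 makes this \<open>1 / (4 * m ^ 2)\<close>;
    \<open>t \<le> 2 * m\<close> then trades one factor \<open>m\<close> for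
    \<open>t\<close>.\<close>
  have "real M ^ 2 * \<kappa> \<le> (10 / (\<epsilon> * m)) ^ 2 * (\<epsilon>\<^sup>2 / 400)"
    using M \<kappa> \<epsilon> m by (intro mult_mono power_mono) (auto simp: m_def)
  also have "\<dots> = 1 / (2 * m * (2 * m))"
    using \<epsilon> m by (simp add: power2_eq_square)
  also have "\<dots> \<le> 1 / (2 * m * t)"
    using tm t m by (intro divide_left_mono mult_left_mono) auto
  finally have "2 * real n * (real M ^ 2 * \<kappa>) \<le> 2 * real n * (1 / (2 * m * t))"
    by (intro mult_left_mono) auto
  then have 1: "2 * real n * (real M ^ 2 * \<kappa>) \<le> real n / (m * t)" by simp
  have "80 * D * \<gamma> ^ 5 / \<epsilon> / (m * (4 * \<gamma>\<^sup>2)) \<le> real n / (m * t)"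
    using n t\<gamma> t m \<gamma> \<epsilon> D by (intro frac_le mult_left_mono) auto
  also have "80 * D * \<gamma> ^ 5 / \<epsilon> / (m * (4 * \<gamma>\<^sup>2)) = D / (\<epsilon> * m) * (20 * \<gamma> ^ 3)"
    using \<gamma> \<epsilon> m by (simp add: field_simps power2_eq_square power3_eq_cube eval_nat_numeral)
  finally have 2: "D / (\<epsilon> * m) * (20 * \<gamma> ^ 3) \<le> real n / (m * t)" .
  have 3: "real M * D \<le> D / (\<epsilon> * m) * 10"
    using mult_right_mono[OF M, of D] D by (simp add: m_def mult_ac)
  have "\<gamma> * (2 * 2) \<le> \<gamma> * (\<gamma> * \<gamma>)" using \<gamma> by (intro mult_left_mono mult_mono) auto
  then have "4 * \<gamma> \<le> \<gamma> ^ 3" by (simp add: power3_eq_cube mult_ac)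
  then have 4: "16 * \<gamma> \<le> 20 * \<gamma> ^ 3 - 10" using \<gamma> by linarith
  \<comment> \<open>The highest level is the worst case: there \<open>\<epsilon> * m\<close> may
    reach 2, and \<open>D\<close> is only known to be at least 1.\<close>
  have "1 / 2 \<le> D / (\<epsilon> * m)"
    using D s(2) \<epsilon> m by (intro frac_le) (auto simp: m_def field_simps)
  then have "1 / 2 * (16 * \<gamma>) \<le> D / (\<epsilon> * m) * (20 * \<gamma> ^ 3 - 10)"
    using 4 \<gamma> D \<epsilon> m by (intro mult_mono) auto
  then have "8 * \<gamma> \<le> D / (\<epsilon> * m) * (20 * \<gamma> ^ 3) - D / (\<epsilon> * m) * 10"
    by (simp add: right_diff_distrib)
  with 1 2 3 show ?thesis by (simp add: m_def[symmetric] t_def[symmetric])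
qed

text \<open>Here \<open>exp D\<close> bounds the number of codewords and \<open>1 - \<kappa>\<close> the distance of the mother code.\<close>
theorem random_puncturing:
  fixes \<epsilon> \<kappa> D :: real
  defines "\<gamma> \<equiv> log 2 (1 / \<epsilon>)"
  assumes \<Omega>: "finite \<Omega>" "\<Omega> \<noteq> {}" and P: "finite P" "real (card P) \<le> exp D"
    and \<epsilon>: "0 < \<epsilon>" "\<epsilon> < 1 / 4" and \<kappa>: "0 \<le> \<kappa>" "\<kappa> \<le> \<epsilon>\<^sup>2 / 400" and D: "1 \<le> D"
    and n: "real n \<ge> 80 * D * \<gamma> ^ 5 / \<epsilon>"
    and dist: "\<And>f h. f \<in> P \<Longrightarrow> h \<in> P \<Longrightarrow> f \<noteq> h \<Longrightarrow>
      real (card {x \<in> \<Omega>. ev f x = ev h x}) \<le> \<kappa> * real (card \<Omega>)"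
  shows "measure_pmf.prob (Pi_pmf {..<n} d (\<lambda>_. pmf_of_set \<Omega>)) {\<alpha>. (\<forall>i<n. \<alpha> i \<in> \<Omega>) \<and>
      (\<forall>f\<in>P. \<forall>h\<in>P. f \<noteq> h \<longrightarrow> real (card {i. i < n \<and> ev f (\<alpha> i) = ev h (\<alpha> i)}) < \<epsilon> * real n) \<and>
      (\<forall>z. \<forall>\<Lambda>\<subseteq>P. (\<forall>f\<in>\<Lambda>. 5 * \<epsilon> * real n \<le> real (card {i. i < n \<and> ev f (\<alpha> i) = z i}))
         \<longrightarrow> real (card \<Lambda>) \<le> 1 / \<epsilon>)} \<ge> 1 / 2"
    (is "measure_pmf.prob _ ?Good \<ge> _")
proof -
  define p where "p = Pi_pmf {..<n} d (\<lambda>_. pmf_of_set \<Omega>)"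
  define often where
    "often M T = {\<alpha>. \<exists>g \<in> {..<M} \<rightarrow>\<^sub>E P. T \<le> real (card {i. i < n \<and> \<alpha> i \<in> collision_points \<Omega> ev M g})}"
    for M and T :: real
  \<comment> \<open>\<open>l\<close> is the least integer above \<open>1 / \<epsilon>\<close>,
    \<open>S\<close> is the last level with \<open>2 ^ s \<le> 2 / \<epsilon>\<close>, and
    \<open>M s\<close> is the least tuple length admissible at level \<open>s\<close> for a list of
    length \<open>l\<close>.\<close>
  define l where "l = Suc (nat \<lfloor>1 / \<epsilon>\<rfloor>)"
  define S where "S = nat \<lfloor>\<gamma> + 1\<rfloor>"
  define M where "M s = nat \<lceil>4 * real l / 2 ^ s\<rceil>" for s :: nat
  define T where "T s = 2 * real n / (2 ^ s * (real s * (real s + 1)))" for s :: nat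
  \<comment> \<open>Pairs agreeing too often spoil the distance, longer tuples the list size. Each
    of the two kinds of failure gets probability 1/4.\<close>
  define Bad where "Bad = often 2 (\<epsilon> * real n) \<union> (\<Union>s\<in>{1..S}. often (M s) (T s))"
  have \<gamma>: "\<gamma> \<ge> 2" unfolding \<gamma>_def using \<epsilon> by (intro two_le_log_inverse)
  have l: "1 / \<epsilon> < real l" "real l \<le> 1 / \<epsilon> + 1" unfolding l_def using \<epsilon> by (auto; linarith)+
  have l': "real l \<le> 5 / (4 * \<epsilon>)" using l(2) \<epsilon> by (simp add: field_simps)
  have n0: "n > 0"
  proof -
    have "80 * D * \<gamma> ^ 5 / \<epsilon> > 0" using D \<gamma> \<epsilon> by simp
    then show ?thesis using n by (metis less_le_trans of_nat_0_less_iff)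
  qed
  have often: "measure_pmf.prob p (often m t) \<le> exp (real m * D + 2 * real n * (real m ^ 2 * \<kappa>) - t)" for m t
    unfolding p_def often_def
    by (rule prob_some_tuple_collides_often_le) (use \<Omega> P \<kappa> dist in auto)
  \<comment> \<open>For pairs the exponent is
    \<open>2 * D + 8 * n * \<kappa> - \<epsilon> * n\<close>. The lower bound on \<open>n\<close>
    gives \<open>\<epsilon> * n \<ge> 2560 * D\<close>, which dominates both positive terms.\<close>
  have "measure_pmf.prob p (often 2 (\<epsilon> * real n)) \<le> 1 / 4"
  proof -
    have "(80 * D) * 2 ^ 5 \<le> (80 * D) * \<gamma> ^ 5" using D \<gamma> by (intro mult_left_mono power_mono) auto
    also have "\<dots> \<le> \<epsilon> * real n" using n \<epsilon> by (simp add: field_simps)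
    finally have \<epsilon>n: "2560 * D \<le> \<epsilon> * real n" by simp
    have "\<epsilon>\<^sup>2 \<le> \<epsilon>" using \<epsilon> by (simp add: power2_eq_square)
    then have "8 * real n * \<kappa> \<le> 8 * real n * (\<epsilon> / 400)"
      using \<kappa> by (intro mult_left_mono) auto
    also have "\<dots> = \<epsilon> * real n / 50" by simp
    finally have "2 * D + 8 * real n * \<kappa> - \<epsilon> * real n \<le> 2 * D - \<epsilon> * real n / 2"
      using \<epsilon>n D by linarith
    also have "\<dots> \<le> - 3" using \<epsilon>n D by linarith
    finally have "exp (2 * D + 8 * real n * \<kappa> - \<epsilon> * real n) \<le> exp (- 3)" by simp
    also have "\<dots> \<le> 1 / (4::real)" using exp_ge_add_one_self[of "3::real"]
      by (simp add: exp_minus field_simps)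
    finally show ?thesis using often[of 2 "\<epsilon> * real n"] by (simp add: mult_ac)
  qed
  moreover have "measure_pmf.prob p (\<Union>s\<in>{1..S}. often (M s) (T s)) \<le> 1 / 4"
  proof -
    have "measure_pmf.prob p (often (M s) (T s)) \<le> exp (- (8 * \<gamma>))" if s: "s \<in> {1..S}" for s
    proof -
      have "real s \<le> \<gamma> + 1" using s \<gamma> unfolding S_def by (simp add: le_nat_iff) linarith
      then have "(2::real) powr s \<le> 2 powr (\<gamma> + 1)" by simp
      then have s2: "2 ^ s \<le> 2 / \<epsilon>" using \<epsilon> by (simp add: powr_realpow \<gamma>_def powr_add)
      \<comment> \<open>The 1 lost to rounding up is at most
        \<open>2 / (\<epsilon> * 2 ^ s)\<close>, as the level satisfies
        \<open>2 ^ s \<le> 2 / \<epsilon>\<close>.\<close>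
      have "real (M s) \<le> 4 * real l / 2 ^ s + 1" unfolding M_def by simp
      also have "\<dots> \<le> 4 * (5 / (4 * \<epsilon>)) / 2 ^ s + 2 / \<epsilon> / 2 ^ s"
        using l' divide_right_mono[OF s2, of "2 ^ s"] by (intro add_mono divide_right_mono) auto
      also have "\<dots> \<le> 10 / (\<epsilon> * 2 ^ s)" using \<epsilon> by (simp add: field_simps)
      finally have Ms: "real (M s) \<le> 10 / (\<epsilon> * 2 ^ s)" .
      have "real (M s) * D + 2 * real n * (real (M s) ^ 2 * \<kappa>) - T s \<le> - (8 * \<gamma>)"
        unfolding T_def \<gamma>_def using \<epsilon> \<kappa> D n s s2 Ms by (intro level_exponent_le) (auto simp: \<gamma>_def)
      with often[of "M s" "T s"] show ?thesis by (meson exp_le_cancel_iff order_trans)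
    qed
    then have "(\<Sum>s\<in>{1..S}. measure_pmf.prob p (often (M s) (T s))) \<le> real S * exp (- (8 * \<gamma>))"
      using sum_bounded_above[of "{1..S}" "\<lambda>s. measure_pmf.prob p (often (M s) (T s))"] by simp
    \<comment> \<open>At most \<open>2 * \<gamma>\<close> levels, each failing with probability at
      most \<open>1 / (8 * \<gamma>)\<close>.\<close>
    also have "\<dots> \<le> (2 * \<gamma>) * (1 / (8 * \<gamma>))"
    proof (intro mult_mono)
      show "real S \<le> 2 * \<gamma>" unfolding S_def using \<gamma> by linarith
      show "exp (- (8 * \<gamma>)) \<le> 1 / (8 * \<gamma>)"
      proof -
        have "8 * \<gamma> \<le> exp (8 * \<gamma>)" using exp_ge_add_one_self[of "8 * \<gamma>"] by linarith
        then show ?thesis using \<gamma> by (simp add: exp_minus inverse_eq_divide frac_le)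
      qed
    qed (use \<gamma> in auto)
    also have "\<dots> = 1 / 4" using \<gamma> by simp
    finally show ?thesis
      using measure_pmf.finite_measure_subadditive_finite[of "{1..S}" "\<lambda>s. often (M s) (T s)" p]
      by (auto intro: order_trans)
  qed
  ultimately have Bad: "measure_pmf.prob p Bad \<le> 1 / 2"
    unfolding Bad_def using measure_Un_le[of "often 2 (\<epsilon> * real n)" p
      "\<Union>s\<in>{1..S}. often (M s) (T s)"] by auto
  \<comment> \<open>Restricted to the support, because the points lie in \<Omega> only almost
    surely.\<close>
  have "\<alpha> \<in> Bad \<union> ?Good" if "\<alpha> \<in> set_pmf p" for \<alpha>
  proof (rule UnCI)
    assume nB: "\<alpha> \<notin> ?Good"
    have \<alpha>: "\<alpha> i \<in> \<Omega>" if "i < n" for i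
      using that \<open>\<alpha> \<in> set_pmf p\<close> \<Omega> by (auto simp: p_def set_Pi_pmf PiE_dflt_def)
    define far where "far \<longleftrightarrow> (\<forall>f\<in>P. \<forall>h\<in>P. f \<noteq> h \<longrightarrow>
      real (card {i. i < n \<and> ev f (\<alpha> i) = ev h (\<alpha> i)}) < \<epsilon> * real n)"
    define short where "short \<longleftrightarrow> (\<forall>z. \<forall>\<Lambda>\<subseteq>P.
      (\<forall>f\<in>\<Lambda>. 5 * \<epsilon> * real n \<le> real (card {i. i < n \<and> ev f (\<alpha> i) = z i}))
         \<longrightarrow> real (card \<Lambda>) \<le> 1 / \<epsilon>)"
    have "\<not> far \<or> \<not> short" using nB \<alpha> by (simp add: far_def short_def)
    then show "\<alpha> \<in> Bad"
    proof
      assume "\<not> far"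
      then obtain f h where 1: "f \<in> P" "h \<in> P" "f \<noteq> h"
        "\<epsilon> * real n \<le> real (card {i. i < n \<and> ev f (\<alpha> i) = ev h (\<alpha> i)})"
        unfolding far_def by (meson linorder_not_less)
      define g where "g = (\<lambda>i\<in>{..<2::nat}. if i = 0 then f else h)"
      have "g \<in> {..<2} \<rightarrow>\<^sub>E P" using 1 by (auto simp: g_def)
      moreover have "{i. i < n \<and> ev f (\<alpha> i) = ev h (\<alpha> i)}
          \<subseteq> {i. i < n \<and> \<alpha> i \<in> collision_points \<Omega> ev 2 g}"
      proof safe
        fix i assume i: "i < n" "ev f (\<alpha> i) = ev h (\<alpha> i)"
        show "\<alpha> i \<in> collision_points \<Omega> ev 2 g"
          unfolding collision_points_def using i \<alpha> 1(3)
          by (auto intro!: exI[of _ 0] exI[of _ "Suc 0"] simp: g_def)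
      qed
      then have "card {i. i < n \<and> ev f (\<alpha> i) = ev h (\<alpha> i)}
          \<le> card {i. i < n \<and> \<alpha> i \<in> collision_points \<Omega> ev 2 g}" by (intro card_mono) auto
      then have "\<epsilon> * real n \<le> real (card {i. i < n \<and> \<alpha> i \<in> collision_points \<Omega> ev 2 g})"
        using 1(4) by linarith
      ultimately have "\<alpha> \<in> often 2 (\<epsilon> * real n)"
        unfolding often_def by blast
      then show ?thesis by (simp add: Bad_def)
    next
      assume "\<not> short"
      then obtain z \<Lambda> where 2: "\<Lambda> \<subseteq> P" "1 / \<epsilon> < real (card \<Lambda>)"
        "\<And>f. f \<in> \<Lambda> \<Longrightarrow> 5 * \<epsilon> * real n \<le> real (card {i. i < n \<and> ev f (\<alpha> i) = z i})"
        unfolding short_def by (meson not_le)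
      have "real (nat \<lfloor>1 / \<epsilon>\<rfloor>) < real (card \<Lambda>)" using 2(2) \<epsilon> by (auto; linarith)
      then have "l \<le> card \<Lambda>" by (simp add: l_def)
      \<comment> \<open>The list is cut down to exactly \<open>l\<close> members, so that the tuple
        lengths \<open>M s\<close> are fixed before the list is known.\<close>
      then obtain \<Lambda>' where \<Lambda>': "\<Lambda>' \<subseteq> \<Lambda>" "card \<Lambda>' = l" "finite \<Lambda>'"
        using obtain_subset_with_card_n by metis
      have "1 \<le> \<epsilon> * real (card \<Lambda>')" using l(1) \<epsilon> \<Lambda>' by (simp add: field_simps)
      then have "\<exists>s\<ge>1. 2 ^ s \<le> card \<Lambda>' \<and> (\<forall>M. 4 * card \<Lambda>' \<le> M * 2 ^ s \<longrightarrow>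
          (\<exists>g \<in> {..<M} \<rightarrow>\<^sub>E \<Lambda>'. 2 * real n / (2 ^ s * (real s * (real s + 1)))
          \<le> real (card {i. i < n \<and> \<alpha> i \<in> collision_points \<Omega> ev M g})))"
        using 2 \<Lambda>' n0 \<alpha> by (intro large_list_yields_colliding_tuple[where \<epsilon> = \<epsilon> and z = z]) auto
      then obtain s where s: "s \<ge> 1" "2 ^ s \<le> l" and
        g: "\<And>M. 4 * l \<le> M * 2 ^ s \<Longrightarrow> \<exists>g \<in> {..<M} \<rightarrow>\<^sub>E \<Lambda>'. T s
          \<le> real (card {i. i < n \<and> \<alpha> i \<in> collision_points \<Omega> ev M g})"
        unfolding \<Lambda>'(2) T_def by blast
      have "4 * real l / 2 ^ s \<le> real (M s)" unfolding M_def by linarith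
      then have "real (4 * l) \<le> real (M s * 2 ^ s)" by (simp add: field_simps)
      then have "4 * l \<le> M s * 2 ^ s" by (simp only: of_nat_le_iff)
      from g[OF this] obtain g where "g \<in> {..<M s} \<rightarrow>\<^sub>E \<Lambda>'"
        "T s \<le> real (card {i. i < n \<and> \<alpha> i \<in> collision_points \<Omega> ev (M s) g})" by blast
      moreover from this(1) have "g \<in> {..<M s} \<rightarrow>\<^sub>E P"
        using \<Lambda>'(1) 2(1) PiE_mono[of "{..<M s}" "\<lambda>_. \<Lambda>'" "\<lambda>_. P"] by blast
      ultimately have "\<alpha> \<in> often (M s) (T s)" unfolding often_def by blast
      \<comment> \<open>The level found lies among those in \<open>Bad\<close>:
        \<open>2 ^ s \<le> l \<le> 2 / \<epsilon>\<close>.\<close>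
      moreover have "s \<le> S"
      proof -
        have "(2::real) ^ s = real (2 ^ s)" by simp
        also have "\<dots> \<le> real l" using s(2) by (simp only: of_nat_le_iff)
        also have "\<dots> \<le> 5 / (4 * \<epsilon>)" by (rule l')
        also have "\<dots> \<le> 2 / \<epsilon>" using \<epsilon> by (simp add: field_simps)
        finally have "(2::real) ^ s \<le> 2 / \<epsilon>" .
        have "real s = log 2 (2 ^ s)" by simp
        also have "\<dots> \<le> log 2 (2 / \<epsilon>)" using \<open>2 ^ s \<le> 2 / \<epsilon>\<close> \<epsilon> by (subst log_le_cancel_iff) auto
        also have "\<dots> = \<gamma> + 1" unfolding \<gamma>_def using \<epsilon> by (simp add: log_divide)
        finally show ?thesis unfolding S_def by linarith
      qed
      ultimately show ?thesis using s(1) by (auto simp: Bad_def)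
    qed
  qed
  then have "measure_pmf.prob p UNIV \<le> measure_pmf.prob p (Bad \<union> ?Good)"
    by (intro measure_pmf.finite_measure_mono_AE) (auto simp: AE_measure_pmf_iff)
  also have "\<dots> \<le> measure_pmf.prob p Bad + measure_pmf.prob p ?Good"
    by (intro measure_Un_le) auto
  finally show ?thesis using Bad by (simp add: p_def)
qed

section \<open>Reed-Solomon codes\<close>

lemma card_set_mset_le_size: "card (set_mset m) \<le> size m"
  using size_mset_mono[OF mset_set_set_mset_msubset[of m]] by simp

lemma (in field) card_polynomial_zeros_le:
  assumes "p \<in> carrier (poly_ring R)" "p \<noteq> []"
  shows "card {x \<in> carrier R. eval p x = \<zero>} \<le> length p - 1"
proof -
  have "{x \<in> carrier R. eval p x = \<zero>} = set_mset (roots p)"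
    using roots_mem_iff_is_root[OF assms(1)] assms(2) by (auto simp: is_root_def)
  then show ?thesis
    using card_set_mset_le_size[of "roots p"] size_roots_le_degree[OF assms(1)] by simp
qed

text \<open>Agreement points are zeros of the nonzero difference, whose degree is again at most
  \<open>k - 1\<close>. This is the distance of the mother code that evaluates on the whole
  field.\<close>

lemma (in field) card_polynomial_agreement_le:
  assumes f: "f \<in> carrier (poly_ring R)" "length f - 1 \<le> k - 1"
    and h: "h \<in> carrier (poly_ring R)" "length h - 1 \<le> k - 1" and "f \<noteq> h"
  shows "card {x \<in> carrier R. eval f x = eval h x} \<le> k - 1"
proof -
  interpret UP: domain "poly_ring R"
    by (rule univ_poly_is_domain[OF carrier_is_subring])
  define d where "d = f \<ominus>\<^bsub>poly_ring R\<^esub> h"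
  have d: "d \<in> carrier (poly_ring R)" using f h by (simp add: d_def)
  have "d \<noteq> \<zero>\<^bsub>poly_ring R\<^esub>" using f h \<open>f \<noteq> h\<close> by (simp add: d_def)
  then have nz: "d \<noteq> []" by (simp add: univ_poly_zero)
  have "d = poly_add f (\<ominus>\<^bsub>poly_ring R\<^esub> h)"
    by (simp add: d_def a_minus_def univ_poly_add)
  then have "length d - 1 \<le> k - 1"
    using poly_add_degree[of f "\<ominus>\<^bsub>poly_ring R\<^esub> h"] f(2) h(2)
      univ_poly_a_inv_length[OF carrier_is_subring h(1)]
    by (simp del: poly_add.simps) linarith
  \<comment> \<open>Writing \<open>f\<close> as \<open>d + h\<close> reduces the claim to additivity
    of evaluation and cancellation of \<open>eval h x\<close>.\<close>
  moreover have "f = d \<oplus>\<^bsub>poly_ring R\<^esub> h"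
    using f h by (simp add: d_def a_minus_def UP.a_assoc UP.l_neg)
  then have f_eq: "f = poly_add d h" by (simp add: univ_poly_add)
  have sets: "set d \<subseteq> carrier R" "set h \<subseteq> carrier R"
    using d h(1) by (auto simp: univ_poly_carrier[symmetric] dest!: polynomial_incl)
  have "eval d x = \<zero>" if "x \<in> carrier R" "eval f x = eval h x" for x
    using eval_poly_add[OF sets that(1)] eval_in_carrier[OF sets(1) that(1)]
      eval_in_carrier[OF sets(2) that(1)] that(2) f_eq by (simp add: add.r_cancel_one)
  then have "card {x \<in> carrier R. eval f x = eval h x} \<le> card {x \<in> carrier R. eval d x = \<zero>}"
    if "finite {x \<in> carrier R. eval d x = \<zero>}"
    using that by (intro card_mono) auto
  moreover have "finite {x \<in> carrier R. eval d x = \<zero>}"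
    using finite_number_of_roots[OF d] nz by (simp add: is_root_def)
  ultimately show ?thesis
    using card_polynomial_zeros_le[OF d nz] by linarith
qed

text \<open>Polynomials are coefficient lists without leading zeros; padding with zeros to length
  \<open>k\<close> inverts \<open>normalize\<close>. For \<open>k = 0\<close> truncated subtraction
  would still admit the constants on the right.\<close>

lemma (in ring) bij_betw_normalize_bounded_degree:
  assumes "1 \<le> k"
  shows "bij_betw normalize {p. set p \<subseteq> carrier R \<and> length p = k}
    {f \<in> carrier (poly_ring R). length f - 1 \<le> k - 1}"
proof (rule bij_betw_imageI)
  show "inj_on normalize {p. set p \<subseteq> carrier R \<and> length p = k}"
  proof (rule inj_onI)
    fix p p' assume "p \<in> {p. set p \<subseteq> carrier R \<and> length p = k}"
      "p' \<in> {p. set p \<subseteq> carrier R \<and> length p = k}" "normalize p = normalize p'"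
    moreover have "x = replicate (length x - length (normalize x)) \<zero> @ normalize x" for x
      using normalize_def'[of x] by simp
    ultimately show "p = p'" by (metis (mono_tags, lifting) mem_Collect_eq)
  qed
  show "normalize ` {p. set p \<subseteq> carrier R \<and> length p = k} =
      {f \<in> carrier (poly_ring R). length f - 1 \<le> k - 1}" (is "_ ` ?A = ?B")
  proof
    show "normalize ` ?A \<subseteq> ?B"
    proof (rule image_subsetI)
      fix p assume p: "p \<in> ?A"
      then have "length (normalize p) - 1 \<le> k - 1" using diff_le_mono[OF normalize_length_le] by auto
      then show "normalize p \<in> ?B"
        using p normalize_gives_polynomial[of p "carrier R"] by (auto simp: univ_poly_carrier)
    qed
    show "?B \<subseteq> normalize ` ?A"
    proof
      fix f assume f: "f \<in> ?B"
      then have pf: "polynomial (carrier R) f" by (simp add: univ_poly_carrier)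
      let ?p = "replicate (k - length f) \<zero> @ f"
      have "?p \<in> ?A" using f polynomial_incl[OF pf] assms by auto
      moreover have "normalize ?p = f"
        using normalize_replicate_zero normalize_polynomial[OF pf] by simp
      ultimately show "f \<in> normalize ` ?A" by (metis imageI)
    qed
  qed
qed

lemma (in ring) card_bounded_degree_polynomials:
  assumes "1 \<le> k" "finite (carrier R)"
  shows "card {f \<in> carrier (poly_ring R). length f - 1 \<le> k - 1} = card (carrier R) ^ k"
    and "finite {f \<in> carrier (poly_ring R). length f - 1 \<le> k - 1}"
  using bij_betw_same_card[OF bij_betw_normalize_bounded_degree[OF assms(1)]]
    bij_betw_finite[OF bij_betw_normalize_bounded_degree[OF assms(1)]]
    card_lists_length_eq[OF assms(2)] finite_lists_length_eq[OF assms(2)]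
  by auto

section \<open>Dimension of the code and rank of its generator matrix\<close>

text \<open>Coordinates with respect to a finite basis give a bijection with the functions from the
  basis to the scalars.\<close>

lemma (in vectorspace) card_carrier_eq_power_dim:
  assumes "fin_dim" "finite (carrier K)"
  shows "card (carrier V) = card (carrier K) ^ dim"
proof -
  obtain \<beta> where \<beta>: "finite \<beta>" "basis \<beta>" using finite_basis_exists[OF assms(1)] by blast
  have "\<beta> \<subseteq> carrier V" using \<beta>(2) by (simp add: basis_def)
  then have unique: "\<forall>v. v \<in> carrier V \<longrightarrow> (\<exists>!a. a \<in> \<beta> \<rightarrow>\<^sub>E carrier K \<and> lincomb a \<beta> = v)"
    using basis_criterion[of \<beta>] \<beta> by blast
  have closed: "lincomb a \<beta> \<in> carrier V" if "a \<in> \<beta> \<rightarrow>\<^sub>E carrier K" for a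
    using that \<open>\<beta> \<subseteq> carrier V\<close> by (intro lincomb_closed) (auto simp: PiE_def)
  have "bij_betw (\<lambda>a. lincomb a \<beta>) (\<beta> \<rightarrow>\<^sub>E carrier K) (carrier V)"
  proof (rule bij_betw_imageI)
    show "inj_on (\<lambda>a. lincomb a \<beta>) (\<beta> \<rightarrow>\<^sub>E carrier K)"
      using unique closed by (intro inj_onI) blast
    show "(\<lambda>a. lincomb a \<beta>) ` (\<beta> \<rightarrow>\<^sub>E carrier K) = carrier V"
      using unique closed by blast
  qed
  then show ?thesis
    using bij_betw_same_card \<beta> dim_basis by (fastforce simp: card_PiE)
qed

text \<open>The head of the list is the leading coefficient, so each induction step splits off one
  monomial. Arbitrary coefficient lists are allowed because the tail of a polynomial may begin with
  zeros.\<close>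

lemma (in field) evaluation_vector_in_span:
  assumes \<alpha>: "\<And>i. i < n \<Longrightarrow> \<alpha> i \<in> carrier R"
    and "set p \<subseteq> carrier R" "length p \<le> k"
  shows "(\<lambda>i\<in>{..<n}. eval p (\<alpha> i)) \<in>
    LinearCombinations.module.span R (func_space {..<n}) (rs_generator R n \<alpha> ` {..<k})"
  using assms(2,3)
proof (induction p)
  interpret M: module R "func_space {..<n}" by (rule func_space_is_module)
  have G: "rs_generator R n \<alpha> ` {..<k} \<subseteq> carrier (func_space {..<n})"
    using \<alpha> by (auto simp: rs_generator_def func_space_def intro!: restrict_PiE_iff[THEN iffD2])
  interpret S: LinearCombinations.submodule R "M.span (rs_generator R n \<alpha> ` {..<k})" "func_space {..<n}"
    by (rule M.span_is_submodule[OF G])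
  {
    case Nil
    have "\<zero>\<^bsub>func_space {..<n}\<^esub> = (\<lambda>i\<in>{..<n}. eval [] (\<alpha> i))"
      by (simp add: func_space_def)
    then show ?case using S.zero_closed by metis
  next
    case (Cons c p)
    have IH: "(\<lambda>i\<in>{..<n}. eval p (\<alpha> i)) \<in> M.span (rs_generator R n \<alpha> ` {..<k})"
      using Cons.prems by (intro Cons.IH) auto
    have "rs_generator R n \<alpha> (length p) \<in> M.span (rs_generator R n \<alpha> ` {..<k})"
      using M.in_own_span[OF G] Cons.prems by auto
    then have "c \<odot>\<^bsub>func_space {..<n}\<^esub> rs_generator R n \<alpha> (length p) \<oplus>\<^bsub>func_space {..<n}\<^esub>
        (\<lambda>i\<in>{..<n}. eval p (\<alpha> i)) \<in> M.span (rs_generator R n \<alpha> ` {..<k})"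
      using Cons.prems by (intro S.m_closed S.smult_closed IH) auto
    also have "c \<odot>\<^bsub>func_space {..<n}\<^esub> rs_generator R n \<alpha> (length p) \<oplus>\<^bsub>func_space {..<n}\<^esub>
        (\<lambda>i\<in>{..<n}. eval p (\<alpha> i)) = (\<lambda>i\<in>{..<n}. eval (c # p) (\<alpha> i))"
      by (auto simp: func_space_def rs_generator_def fun_eq_iff)
    finally show ?case .
  }
qed

lemma (in field) reed_solomon_dimension:
  assumes "finite (carrier R)" "1 \<le> k" and \<alpha>: "\<And>i. i < n \<Longrightarrow> \<alpha> i \<in> carrier R"
    and inj: "inj_on (\<lambda>f. \<lambda>i\<in>{..<n}. eval f (\<alpha> i)) {f \<in> carrier (poly_ring R). length f - 1 \<le> k - 1}"
  shows "column_rank R n k (rs_generator R n \<alpha>) = k"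
    and "code_dim R n (reed_solomon R n k \<alpha>) = k"
proof -
  define q where "q = card (carrier R)"
  interpret V: vectorspace R "func_space {..<n}"
    using func_space_is_module field_axioms by (simp add: vectorspace_def)
  define G where "G = rs_generator R n \<alpha> ` {..<k}"
  define W where "W = V.span G"
  have G: "G \<subseteq> carrier (func_space {..<n})"
    using \<alpha> by (auto simp: G_def rs_generator_def func_space_def intro!: restrict_PiE_iff[THEN iffD2])
  have finG: "finite G" "card G \<le> k"
    unfolding G_def by (auto intro: card_image_le[THEN order_trans])
  have sub: "LinearCombinations.submodule R W (func_space {..<n})"
    unfolding W_def by (rule V.span_is_submodule[OF G])
  have GW: "G \<subseteq> W" unfolding W_def by (rule V.in_own_span[OF G])
  interpret W: vectorspace R "func_space {..<n}\<lparr>carrier := W\<rparr>"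
    unfolding W_def by (rule V.subspace_is_vs[OF V.span_is_subspace[OF G]])
  \<comment> \<open>The span has to be taken inside \<open>W\<close>, as the dimension bound is a
    statement about \<open>W\<close> as a space of its own.\<close>
  have gen: "W.span G = carrier (func_space {..<n}\<lparr>carrier := W\<rparr>)"
    using V.span_li_not_depend(1)[OF GW sub] by (simp add: W_def)
  have fd: "W.fin_dim" unfolding W.fin_dim_def using finG GW gen by auto
  have "W.dim \<le> card G" using W.gen_ge_dim[OF finG(1) _ gen] GW by simp
  then have le: "W.dim \<le> k" using finG by simp
  have cW: "card W = q ^ W.dim"
    using W.card_carrier_eq_power_dim[OF fd assms(1)] by (simp add: q_def)
  have "finite (carrier (func_space {..<n}))"
    unfolding func_space_def using assms(1) by (simp add: finite_PiE)
  then have finW: "finite W" using V.span_is_subset2[OF G] by (simp add: W_def finite_subset)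
  let ?C = "reed_solomon R n k \<alpha>"
  have cC: "card ?C = q ^ k"
    unfolding reed_solomon_def
    using card_image[OF inj] card_bounded_degree_polynomials(1)[OF assms(2,1)] by (simp add: q_def)
  have CW: "?C \<subseteq> W"
  proof
    fix c assume "c \<in> ?C"
    then obtain f where f: "f \<in> carrier (poly_ring R)" "length f - 1 \<le> k - 1"
      "c = (\<lambda>i\<in>{..<n}. eval f (\<alpha> i))" by (auto simp: reed_solomon_def)
    have "set f \<subseteq> carrier R" using f(1) by (auto simp: univ_poly_carrier[symmetric] dest!: polynomial_incl)
    moreover have "length f \<le> k" using f(2) assms(2) by linarith
    ultimately show "c \<in> W"
      unfolding W_def G_def f(3) by (intro evaluation_vector_in_span \<alpha>)
  qed
  have q: "q > 1"
  proof -
    have "card {\<zero>, \<one>} \<le> q" unfolding q_def using assms(1) by (intro card_mono) auto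
    then show ?thesis by simp
  qed
  \<comment> \<open>Counting replaces a linear independence argument: \<open>W\<close> has at most \<open>k\<close> generators but
    contains the \<open>q ^ k\<close> codewords.\<close>
  have "q ^ k \<le> q ^ W.dim" using card_mono[OF finW CW] cC cW by simp
  then have dim: "W.dim = k" using q le by (simp add: power_increasing_iff)
  then have "?C = W" using CW cC cW finW by (intro card_subset_eq) auto
  with dim show "code_dim R n ?C = k" by (simp add: code_dim_def)
  show "column_rank R n k (rs_generator R n \<alpha>) = k"
    using dim by (simp add: column_rank_def code_dim_def W_def G_def)
qed

section \<open>From agreement counts to code parameters\<close>

lemma rel_hamming_eq:
  assumes "n > 0"
  shows "rel_hamming n x y = 1 - real (card {i. i < n \<and> x i = y i}) / real n"
proof -
  have "{..<n} = {i. i < n \<and> x i = y i} \<union> {i. i < n \<and> x i \<noteq> y i}" by auto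
  then have "card {..<n} = card {i. i < n \<and> x i = y i} + card {i. i < n \<and> x i \<noteq> y i}"
    by (simp only:) (rule card_Un_disjoint; auto)
  then have "real (card {i. i < n \<and> x i \<noteq> y i}) = real n - real (card {i. i < n \<and> x i = y i})"
    by simp
  then show ?thesis using assms by (simp add: rel_hamming_def diff_divide_distrib)
qed

text \<open>The deterministic half of the argument. Fewer than \<open>\<epsilon> * n\<close>
  agreements leave at least one difference, so encoding is injective and rank and dimension follow;
  the same count gives the distance.\<close>

lemma (in field) reed_solomon_good:
  fixes \<epsilon> :: real and k n :: nat
  defines "P \<equiv> {f \<in> carrier (poly_ring R). length f - 1 \<le> k - 1}"
  assumes fin: "finite (carrier R)" and "1 \<le> k" "n > 0" "\<epsilon> \<le> 1"
    and \<alpha>: "\<And>i. i < n \<Longrightarrow> \<alpha> i \<in> carrier R"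
    and dist: "\<And>f h. f \<in> P \<Longrightarrow> h \<in> P \<Longrightarrow> f \<noteq> h \<Longrightarrow>
      real (card {i. i < n \<and> eval f (\<alpha> i) = eval h (\<alpha> i)}) < \<epsilon> * real n"
    and few: "\<And>z \<Lambda>. \<Lambda> \<subseteq> P \<Longrightarrow>
      (\<And>f. f \<in> \<Lambda> \<Longrightarrow> 5 * \<epsilon> * real n \<le> real (card {i. i < n \<and> eval f (\<alpha> i) = z i})) \<Longrightarrow>
      real (card \<Lambda>) \<le> 1 / \<epsilon>"
  shows "column_rank R n k (rs_generator R n \<alpha>) = k"
    and "code_dim R n (reed_solomon R n k \<alpha>) = k"
    and "code_distance n (reed_solomon R n k \<alpha>) \<ge> 1 - \<epsilon>"
    and "list_decodable R n (1 - 5 * \<epsilon>) (1 / \<epsilon>) (reed_solomon R n k \<alpha>)"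
proof -
  define enc where "enc f = (\<lambda>i\<in>{..<n}. eval f (\<alpha> i))" for f
  define C where "C = reed_solomon R n k \<alpha>"
  have C: "C = enc ` P" by (simp add: C_def P_def reed_solomon_def enc_def[abs_def])
  have agree: "{i. i < n \<and> enc f i = enc h i} = {i. i < n \<and> eval f (\<alpha> i) = eval h (\<alpha> i)}" for f h
    by (auto simp: enc_def)
  have "real (card {i. i < n \<and> enc f i = enc h i}) < real n" if "f \<in> P" "h \<in> P" "f \<noteq> h" for f h
  proof -
    have "\<epsilon> * real n \<le> 1 * real n" using \<open>\<epsilon> \<le> 1\<close> by (intro mult_right_mono) auto
    then show ?thesis using dist[OF that] by (simp add: agree)
  qed
  then have inj: "inj_on enc P" by (intro inj_onI) (fastforce)
  have cP: "card P = card (carrier R) ^ k" "finite P"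
    unfolding P_def using card_bounded_degree_polynomials assms(3) fin by auto
  show "column_rank R n k (rs_generator R n \<alpha>) = k" "code_dim R n (reed_solomon R n k \<alpha>) = k"
    using reed_solomon_dimension[OF fin assms(3) \<alpha>] inj by (auto simp: enc_def[abs_def] P_def)
  \<comment> \<open>Two distinct codewords are exhibited, since the minimum in
    \<open>code_distance\<close> is meaningful only over a nonempty set.\<close>
  have "card {\<zero>, \<one>} \<le> card (carrier R)" using fin by (intro card_mono) auto
  then have "2 \<le> card (carrier R) ^ 1" by simp
  also have "\<dots> \<le> card (carrier R) ^ k" using \<open>2 \<le> card (carrier R) ^ 1\<close> assms(3) by (intro power_increasing) auto
  finally have "2 \<le> card C" by (simp add: C card_image[OF inj] cP)
  then obtain c c' where cc: "c \<in> C" "c' \<in> C" "c \<noteq> c'"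
    using card_le_Suc0_iff_eq[of C] cP C by (metis One_nat_def Suc_1 finite_imageI not_less_eq_eq)
  let ?D = "{rel_hamming n c c' | c c'. c \<in> C \<and> c' \<in> C \<and> c \<noteq> c'}"
  have "?D \<subseteq> (\<lambda>(c, c'). rel_hamming n c c') ` (C \<times> C)" by auto
  moreover have "finite C" using cP C by simp
  ultimately have "finite ?D" by (meson finite_SigmaI finite_imageI finite_subset)
  moreover have "?D \<noteq> {}" using cc by blast
  moreover have "1 - \<epsilon> \<le> rel_hamming n c c'" if c: "c \<in> C" "c' \<in> C" "c \<noteq> c'" for c c'
  proof -
    obtain f h where fh: "f \<in> P" "h \<in> P" "c = enc f" "c' = enc h" using c C by auto
    then have "f \<noteq> h" using c by auto
    from dist[OF fh(1,2) this] show ?thesis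
      using \<open>n > 0\<close> by (simp add: rel_hamming_eq fh agree field_simps)
  qed
  ultimately have "1 - \<epsilon> \<le> Min ?D" by (subst Min_ge_iff) auto
  then show "code_distance n (reed_solomon R n k \<alpha>) \<ge> 1 - \<epsilon>"
    by (simp add: code_distance_def C_def)
  have "real (card {c \<in> C. rel_hamming n z c \<le> 1 - 5 * \<epsilon>}) \<le> 1 / \<epsilon>" for z
  proof -
    \<comment> \<open>The codewords near \<open>z\<close> are pulled back to polynomials, where the
      list bound is available.\<close>
    define \<Lambda> where "\<Lambda> = {f \<in> P. rel_hamming n z (enc f) \<le> 1 - 5 * \<epsilon>}"
    have "{c \<in> C. rel_hamming n z c \<le> 1 - 5 * \<epsilon>} = enc ` \<Lambda>" by (auto simp: C \<Lambda>_def)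
    then have "card {c \<in> C. rel_hamming n z c \<le> 1 - 5 * \<epsilon>} \<le> card \<Lambda>"
      using card_image_le[of \<Lambda> enc] cP by (simp add: \<Lambda>_def)
    moreover have "real (card \<Lambda>) \<le> 1 / \<epsilon>"
    proof (rule few[of _ z])
      fix f assume "f \<in> \<Lambda>"
      then have "5 * \<epsilon> \<le> real (card {i. i < n \<and> z i = enc f i}) / real n"
        by (simp add: \<Lambda>_def rel_hamming_eq[OF \<open>n > 0\<close>])
      moreover have "{i. i < n \<and> z i = enc f i} = {i. i < n \<and> eval f (\<alpha> i) = z i}"
        by (auto simp: enc_def)
      ultimately show "5 * \<epsilon> * real n \<le> real (card {i. i < n \<and> eval f (\<alpha> i) = z i})"
        using \<open>n > 0\<close> by (simp add: field_simps)
    qed (simp add: \<Lambda>_def)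
    ultimately show ?thesis by linarith
  qed
  then show "list_decodable R n (1 - 5 * \<epsilon>) (1 / \<epsilon>) (reed_solomon R n k \<alpha>)"
    by (simp add: list_decodable_def C_def)
qed

text \<open>Puncturing is applied to all polynomials of degree at most \<open>k - 1\<close>,
  evaluated on the whole field, with agreement fraction \<open>k / q\<close>.\<close>

lemma (in field) prob_random_reed_solomon_good:
  fixes \<epsilon> C\<^sub>2 :: real and k n :: nat
  defines "q \<equiv> card (carrier R)"
  defines "D \<equiv> log 2 (real q ^ k)"
  assumes fin: "finite (carrier R)" and \<epsilon>: "0 < \<epsilon>" "\<epsilon> < 1 / 4" and k: "1 \<le> k" and "C\<^sub>2 > 0"
    and q: "real q \<ge> 400 * (real k / \<epsilon>\<^sup>2)" "real q > 1 / \<epsilon>\<^sup>2"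
    and n: "real n \<ge> 80 * D * log 2 (1 / \<epsilon>) ^ 5 / \<epsilon>"
      "real n \<le> C\<^sub>2 * (D * log 2 (1 / \<epsilon>) ^ 5 / \<epsilon>)"
  shows "measure_pmf.prob (random_points R n)
    {\<alpha>. column_rank R n k (rs_generator R n \<alpha>) = k \<and>
        code_rate R n (reed_solomon R n k \<alpha>)
          \<ge> 1 / C\<^sub>2 * (\<epsilon> / (log 2 (real q) * log 2 (1 / \<epsilon>) ^ 5)) \<and>
        code_distance n (reed_solomon R n k \<alpha>) \<ge> 1 - \<epsilon> \<and>
        list_decodable R n (1 - 5 * \<epsilon>) (1 / \<epsilon>) (reed_solomon R n k \<alpha>)} \<ge> 1 / 2"
    (is "measure_pmf.prob _ ?Target \<ge> _")
proof -
  define \<gamma> where "\<gamma> = log 2 (1 / \<epsilon>)"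
  define P where "P = {f \<in> carrier (poly_ring R). length f - 1 \<le> k - 1}"
  define \<kappa> where "\<kappa> = real k / real q"
  have \<gamma>: "\<gamma> \<ge> 2" unfolding \<gamma>_def using \<epsilon> by (rule two_le_log_inverse)
  have "\<epsilon>\<^sup>2 \<le> (1 / 4)\<^sup>2" using \<epsilon> by (intro power_mono) auto
  then have "1 / \<epsilon>\<^sup>2 \<ge> 16" using \<epsilon> by (simp add: field_simps power2_eq_square)
  with q have q16: "real q > 16" by linarith
  have "log 2 (2 powr 1) \<le> log 2 (real q)" using q16 by (subst log_le_cancel_iff) auto
  then have lq: "log 2 (real q) \<ge> 1" by (simp only: log_powr_cancel)
  have Dq: "D = real k * log 2 (real q)" unfolding D_def using q16 by (simp add: log_nat_power)
  have "1 * 1 \<le> real k * ln (real q)"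
  proof (intro mult_mono)
    have "exp 1 \<le> real q" using exp_le q16 by linarith
    then show "1 \<le> ln (real q)" using q16 by (simp add: ln_ge_iff)
  qed (use k in auto)
  then have lnN: "1 \<le> ln (real q ^ k)" using q16 by (simp add: ln_realpow)
  \<comment> \<open>The union bound counts codewords with the natural logarithm, while the block
    length is stated with base 2; the latter logarithm is the larger one.\<close>
  have "ln (real q ^ k) * ln 2 \<le> ln (real q ^ k) * 1"
    using lnN ln_2_less_1 by (intro mult_left_mono) auto
  then have lnD: "ln (real q ^ k) \<le> D"
    by (simp add: D_def log_def le_divide_eq)
  have n0: "n > 0"
  proof -
    have "80 * D * \<gamma> ^ 5 / \<epsilon> > 0" using lnD lnN \<gamma> \<epsilon> by simp
    then show ?thesis using n(1) by (metis \<gamma>_def less_le_trans of_nat_0_less_iff)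
  qed
  have "80 * ln (real q ^ k) * log 2 (1 / \<epsilon>) ^ 5 / \<epsilon> \<le> 80 * D * log 2 (1 / \<epsilon>) ^ 5 / \<epsilon>"
    using lnD \<gamma> \<epsilon> by (intro divide_right_mono mult_right_mono) (auto simp: \<gamma>_def)
  then have n': "80 * ln (real q ^ k) * log 2 (1 / \<epsilon>) ^ 5 / \<epsilon> \<le> real n" using n(1) by linarith
  have "400 * real k / \<epsilon>\<^sup>2 \<le> real q" using q by simp
  then have \<kappa>: "0 \<le> \<kappa>" "\<kappa> \<le> \<epsilon>\<^sup>2 / 400"
    using q16 \<epsilon> by (auto simp: \<kappa>_def field_simps)
  let ?Good = "{\<alpha>. (\<forall>i<n. \<alpha> i \<in> carrier R) \<and>
      (\<forall>f\<in>P. \<forall>h\<in>P. f \<noteq> h \<longrightarrow> real (card {i. i < n \<and> eval f (\<alpha> i) = eval h (\<alpha> i)}) < \<epsilon> * real n) \<and>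
      (\<forall>z. \<forall>\<Lambda>\<subseteq>P. (\<forall>f\<in>\<Lambda>. 5 * \<epsilon> * real n \<le> real (card {i. i < n \<and> eval f (\<alpha> i) = z i}))
         \<longrightarrow> real (card \<Lambda>) \<le> 1 / \<epsilon>)}"
  have "1 / 2 \<le> measure_pmf.prob (Pi_pmf {..<n} undefined (\<lambda>_. pmf_of_set (carrier R))) ?Good"
  proof (rule random_puncturing[OF fin _ _ _ \<epsilon> \<kappa> lnN n'])
    show "carrier R \<noteq> {}" by auto
    show "finite P" "real (card P) \<le> exp (ln (real q ^ k))"
      unfolding P_def using card_bounded_degree_polynomials[OF k fin] q16 by (auto simp: q_def)
    fix f h assume "f \<in> P" "h \<in> P" "f \<noteq> h"
    then have "card {x \<in> carrier R. eval f x = eval h x} \<le> k - 1"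
      unfolding P_def by (intro card_polynomial_agreement_le) auto
    then have "real (card {x \<in> carrier R. eval f x = eval h x}) \<le> real k" by simp
    also have "\<dots> = \<kappa> * real (card (carrier R))" using q16 by (simp add: \<kappa>_def q_def)
    finally show "real (card {x \<in> carrier R. eval f x = eval h x}) \<le> \<kappa> * real (card (carrier R))" .
  qed
  also have "\<dots> \<le> measure_pmf.prob (random_points R n) ?Target"
    unfolding random_points_def
  proof (intro measure_pmf.finite_measure_mono subsetI)
    fix \<alpha> assume good: "\<alpha> \<in> ?Good"
    have "\<epsilon> \<le> 1" using \<epsilon> by simp
    note rs = reed_solomon_good[OF fin k n0 this, of \<alpha>, folded P_def]
    have props: "column_rank R n k (rs_generator R n \<alpha>) = k"
      "code_dim R n (reed_solomon R n k \<alpha>) = k"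
      "code_distance n (reed_solomon R n k \<alpha>) \<ge> 1 - \<epsilon>"
      "list_decodable R n (1 - 5 * \<epsilon>) (1 / \<epsilon>) (reed_solomon R n k \<alpha>)"
      by (rule rs; use good in blast)+
    \<comment> \<open>The rate \<open>k / n\<close> is bounded below through the upper bound on
      \<open>n\<close>: as \<open>D = k * log 2 q\<close>, the factor \<open>k\<close> cancels and
      the constant \<open>1 / C\<^sub>2\<close> remains.\<close>
    have "\<epsilon> * real n \<le> \<epsilon> * (C\<^sub>2 * (D * \<gamma> ^ 5 / \<epsilon>))"
      using n(2) \<epsilon> by (intro mult_left_mono) (auto simp: \<gamma>_def)
    then have "\<epsilon> * real n \<le> real k * (C\<^sub>2 * (log 2 (real q) * \<gamma> ^ 5))"
      using \<epsilon> by (simp add: Dq mult_ac)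
    then have "\<epsilon> / (C\<^sub>2 * (log 2 (real q) * \<gamma> ^ 5)) \<le> real k / real n"
      using \<open>C\<^sub>2 > 0\<close> lq \<gamma> n0 by (simp add: divide_le_eq le_divide_eq mult_ac)
    then have "1 / C\<^sub>2 * (\<epsilon> / (log 2 (real q) * log 2 (1 / \<epsilon>) ^ 5)) \<le> code_rate R n (reed_solomon R n k \<alpha>)"
      by (simp add: code_rate_def props \<gamma>_def)
    with props show "\<alpha> \<in> ?Target" by simp
  qed auto
  finally show ?thesis .
qed

text \<open>The constant \<open>C\<^sub>2\<close> in the upper bound on \<open>n\<close> is
  arbitrary, and only the rate constant \<open>c\<close> may depend on it; \<open>c\<close> is
  uniform over all fields. Distance \<open>1 - \<epsilon>\<close> is read as a lower bound.\<close>

theorem mainTheorem4: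
  shows "\<exists>C\<^sub>0 C\<^sub>1 \<epsilon>\<^sub>0 p :: real. C\<^sub>0 > 0 \<and> C\<^sub>1 > 0 \<and> \<epsilon>\<^sub>0 > 0 \<and> p > 0 \<and>
    (\<forall>C\<^sub>2 > 0. \<exists>c > 0. \<forall>(F :: 'a ring) (\<epsilon> :: real) (k :: nat) (n :: nat) (q :: nat) (N :: real) (L :: real).
      field F \<longrightarrow> finite (carrier F) \<longrightarrow> q = card (carrier F) \<longrightarrow>
      0 < \<epsilon> \<longrightarrow> \<epsilon> < \<epsilon>\<^sub>0 \<longrightarrow> 1 \<le> k \<longrightarrow>
      n \<le> q \<longrightarrow> real q \<ge> C\<^sub>1 * (real k / \<epsilon>\<^sup>2) \<longrightarrow> real q > 1 / \<epsilon>\<^sup>2 \<longrightarrow>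
      N = real q ^ k \<longrightarrow> L = 1 / \<epsilon> \<longrightarrow>
      real n \<ge> 2 * C\<^sub>0 * log 2 N * (log 2 L) ^ 5 / \<epsilon> \<longrightarrow>
      real n \<le> C\<^sub>2 * (log 2 N * (log 2 (1 / \<epsilon>)) ^ 5 / \<epsilon>) \<longrightarrow>
      measure_pmf.prob (random_points F n)
        {\<alpha>. column_rank F n k (rs_generator F n \<alpha>) = k \<and>
            code_rate F n (reed_solomon F n k \<alpha>) \<ge> c * (\<epsilon> / (log 2 (real q) * (log 2 (1 / \<epsilon>)) ^ 5)) \<and>
            code_distance n (reed_solomon F n k \<alpha>) \<ge> 1 - \<epsilon> \<and>
            list_decodable F n (1 - 5 * \<epsilon>) (1 / \<epsilon>) (reed_solomon F n k \<alpha>)} \<ge> p)"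
\<comment> \<open>\<open>2 * 40\<close> is the factor 80 of the puncturing bound, 400 bounds the
  agreement fraction by \<open>\<epsilon>\<^sup>2 / 400\<close>, and 1/4 ensures that the logarithm
  of \<open>1 / \<epsilon>\<close> is at least 2.\<close>
proof (rule exI[of _ 40], rule exI[of _ 400], rule exI[of _ "1 / 4"], rule exI[of _ "1 / 2"],
    intro conjI allI impI)
  fix C\<^sub>2 :: real
  assume C\<^sub>2: "C\<^sub>2 > 0"
  show "\<exists>c > 0. \<forall>(F :: 'a ring) (\<epsilon> :: real) (k :: nat) (n :: nat) (q :: nat) (N :: real) (L :: real).
      field F \<longrightarrow> finite (carrier F) \<longrightarrow> q = card (carrier F) \<longrightarrow>
      0 < \<epsilon> \<longrightarrow> \<epsilon> < 1 / 4 \<longrightarrow> 1 \<le> k \<longrightarrow>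
      n \<le> q \<longrightarrow> real q \<ge> 400 * (real k / \<epsilon>\<^sup>2) \<longrightarrow> real q > 1 / \<epsilon>\<^sup>2 \<longrightarrow>
      N = real q ^ k \<longrightarrow> L = 1 / \<epsilon> \<longrightarrow>
      real n \<ge> 2 * 40 * log 2 N * (log 2 L) ^ 5 / \<epsilon> \<longrightarrow>
      real n \<le> C\<^sub>2 * (log 2 N * (log 2 (1 / \<epsilon>)) ^ 5 / \<epsilon>) \<longrightarrow>
      measure_pmf.prob (random_points F n)
        {\<alpha>. column_rank F n k (rs_generator F n \<alpha>) = k \<and>
            code_rate F n (reed_solomon F n k \<alpha>) \<ge> c * (\<epsilon> / (log 2 (real q) * (log 2 (1 / \<epsilon>)) ^ 5)) \<and>
            code_distance n (reed_solomon F n k \<alpha>) \<ge> 1 - \<epsilon> \<and>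
            list_decodable F n (1 - 5 * \<epsilon>) (1 / \<epsilon>) (reed_solomon F n k \<alpha>)} \<ge> 1 / 2"
    by (rule exI[of _ "1 / C\<^sub>2"], intro conjI allI impI, use C\<^sub>2 in simp, hypsubst,
        rule field.prob_random_reed_solomon_good) (use C\<^sub>2 in auto)
qed auto

end
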